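(* Let $V$ be a real Euclidean vector space of dimension $n$, $\Phi\subseteq V$ a root system, $\mathcal{W}$ the finite reflection group it defines, and $\eta_1,\dots,\eta_n$ homogeneous basic invariants of $\mathcal{W}$ of degrees $d_1\le\dots\le d_n$. Let $\mathbb{P}^n$ have homogeneous coordinates $x_0,x_1,\dots,x_n$, where $x_1,\dots,x_n$ are coordinates on $V\otimes_{\mathbb{R}}\mathbb{C}$, and let $y\in V$ be a point at which the Jacobian determinant of the Chevalley mapping $x\mapsto(\eta_1(x),\dots,\eta_n(x))$ does not vanish. Let $\mathcal{C}_y\subseteq\mathbb{P}^n$ be the curve defined by $(\eta_i-\eta_i(y)x_0^{d_i}:1\le i\le n-1)$. If $F$ is a $\mathcal{W}$-invariant homogeneous polynomial in $x_1,\dots,x_n$ of degree $d<2d_n$ whose hypersurface $V(F)\subseteq\mathbb{P}^n$ is singular at the point $[1:y]$, then $V(F)$ contains $\mathcal{C}_y$.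
   Context: A root system is a finite set $\Phi$ of vectors such that the only multiples of $v\in\Phi$ in $\Phi$ are $\pm v$ and $\Phi$ is stable under the orthogonal reflections in the hyperplanes perpendicular to its elements; $\mathcal{W}$ is the group generated by these reflections, acting on polynomials by $(wf)(x)=f(w^{-1}x)$ and on $\mathbb{P}^n$ by acting on $x_1,\dots,x_n$ and fixing $x_0$. Basic invariants are $n$ algebraically independent homogeneous generators of the invariant algebra (they exist by Chevalley's theorem). *)

theory Defs
  imports "HOL-Analysis.Analysis" "HOL-Library.Poly_Mapping"
begin

subsection \<open>Multivariate polynomials\<close>

text \<open>Polynomials over \<open>'k\<close> in variables indexed by \<open>'v\<close> are finitely supported maps from
  monomials (exponent vectors) to coefficients; the ring structure, with convolution as
  multiplication, is the one of \<open>Poly_Mapping\<close>.\<close>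

type_synonym ('v, 'k) mpoly = "('v \<Rightarrow>\<^sub>0 nat) \<Rightarrow>\<^sub>0 'k"

definition Const :: "'k::zero \<Rightarrow> ('v, 'k) mpoly" where
  "Const c = Poly_Mapping.single 0 c"

definition Var :: "'v \<Rightarrow> ('v, 'k::zero_neq_one) mpoly" where
  "Var v = Poly_Mapping.single (Poly_Mapping.single v 1) 1"

text \<open>Substitution in a commutative ring: \<open>\<phi>\<close> is applied to the coefficients, \<open>\<sigma>\<close> to the
  variables.\<close>

definition poly_subst ::
    "('k::zero \<Rightarrow> 'b::comm_ring_1) \<Rightarrow> ('v \<Rightarrow> 'b) \<Rightarrow> ('v, 'k) mpoly \<Rightarrow> 'b" where
  "poly_subst \<phi> \<sigma> p =
     (\<Sum>m\<in>Poly_Mapping.keys p. \<phi> (Poly_Mapping.lookup p m) *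
        (\<Prod>v\<in>Poly_Mapping.keys m. \<sigma> v ^ Poly_Mapping.lookup m v))"

definition eval :: "('v::finite, 'k::comm_ring_1) mpoly \<Rightarrow> 'k ^ 'v \<Rightarrow> 'k" where
  "eval p x = poly_subst (\<lambda>c. c) (\<lambda>v. x $ v) p"

definition poly_comp ::
    "('w \<Rightarrow> ('v, 'k::comm_ring_1) mpoly) \<Rightarrow> ('w, 'k) mpoly \<Rightarrow> ('v, 'k) mpoly" where
  "poly_comp g p = poly_subst Const g p"

definition homogeneous :: "nat \<Rightarrow> ('v, 'k::zero) mpoly \<Rightarrow> bool" where
  "homogeneous d p \<longleftrightarrow>
     (\<forall>m\<in>Poly_Mapping.keys p. (\<Sum>v\<in>Poly_Mapping.keys m. Poly_Mapping.lookup m v) = d)"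

text \<open>Formal partial derivative. For monomials not containing \<open>v\<close> the truncated difference of
  exponents is harmless, since the coefficient is then zero.\<close>

definition partial_deriv :: "'v \<Rightarrow> ('v, 'k::comm_ring_1) mpoly \<Rightarrow> ('v, 'k) mpoly" where
  "partial_deriv v p =
     (\<Sum>m\<in>Poly_Mapping.keys p.
        Poly_Mapping.single (m - Poly_Mapping.single v 1)
          (of_nat (Poly_Mapping.lookup m v) * Poly_Mapping.lookup p m))"

definition alg_independent :: "('w \<Rightarrow> ('v, 'k::comm_ring_1) mpoly) \<Rightarrow> bool" where
  "alg_independent g \<longleftrightarrow> (\<forall>p. poly_comp g p = 0 \<longrightarrow> p = 0)"

definition complexify :: "('v, real) mpoly \<Rightarrow> ('v, complex) mpoly" where
  "complexify p = poly_subst (\<lambda>c. Const (complex_of_real c)) Var p"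


subsection \<open>Root systems, reflection groups and their invariants\<close>

definition reflection :: "'a::real_inner \<Rightarrow> 'a \<Rightarrow> 'a" where
  "reflection v x = x - (2 * (v \<bullet> x) / (v \<bullet> v)) *\<^sub>R v"

text \<open>Neither crystallographic nor spanning. The zero vector is excluded because it has no
  perpendicular hyperplane.\<close>

definition root_system :: "'a::real_inner set \<Rightarrow> bool" where
  "root_system \<Phi> \<longleftrightarrow> finite \<Phi> \<and> 0 \<notin> \<Phi> \<and>
     (\<forall>v\<in>\<Phi>. {w\<in>\<Phi>. \<exists>c. w = c *\<^sub>R v} = {v, - v}) \<and>
     (\<forall>v\<in>\<Phi>. reflection v ` \<Phi> = \<Phi>)"

inductive_set reflection_group :: "'a::real_inner set \<Rightarrow> ('a \<Rightarrow> 'a) set" for \<Phi> where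
  one: "id \<in> reflection_group \<Phi>"
| gen: "v \<in> \<Phi> \<Longrightarrow> reflection v \<in> reflection_group \<Phi>"
| inv: "w \<in> reflection_group \<Phi> \<Longrightarrow> inv w \<in> reflection_group \<Phi>"
| mult: "w \<in> reflection_group \<Phi> \<Longrightarrow> w' \<in> reflection_group \<Phi> \<Longrightarrow> w \<circ> w' \<in> reflection_group \<Phi>"

text \<open>The polynomial \<open>w f\<close> with \<open>(w f)(x) = f (w\<^sup>-\<^sup>1 x)\<close>: the variable \<open>x\<^sub>i\<close> is replaced by the
  linear form that is the \<open>i\<close>-th coordinate of \<open>w\<^sup>-\<^sup>1 x\<close>.\<close>

definition act ::
    "(real ^ 'n \<Rightarrow> real ^ 'n) \<Rightarrow> ('n::finite, 'k::real_field) mpoly \<Rightarrow> ('n, 'k) mpoly" where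
  "act w f = poly_comp (\<lambda>i. \<Sum>j\<in>UNIV. Const (of_real (matrix (inv w) $ i $ j)) * Var j) f"

definition invariants ::
    "(real ^ 'n \<Rightarrow> real ^ 'n) set \<Rightarrow> ('n::finite, 'k::real_field) mpoly set" where
  "invariants W = {f. \<forall>w\<in>W. act w f = f}"

definition basic_invariants ::
    "(real ^ 'n \<Rightarrow> real ^ 'n) set \<Rightarrow> ('n \<Rightarrow> ('n::finite, real) mpoly) \<Rightarrow> ('n \<Rightarrow> nat) \<Rightarrow> bool" where
  "basic_invariants W \<eta> dg \<longleftrightarrow>
     (\<forall>i. homogeneous (dg i) (\<eta> i)) \<and> alg_independent \<eta> \<and> range (poly_comp \<eta>) = invariants W"

definition chevalley_map :: "('n \<Rightarrow> ('n::finite, real) mpoly) \<Rightarrow> real ^ 'n \<Rightarrow> real ^ 'n" where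
  "chevalley_map \<eta> x = (\<chi> i. eval (\<eta> i) x)"


subsection \<open>Projective space\<close>

text \<open>Complex projective space with homogeneous coordinates indexed by \<open>'n option\<close>: the extra
  coordinate \<open>x\<^sub>0\<close> has index \<open>None\<close>. A point is the set of all its homogeneous coordinate
  vectors.\<close>

definition proj_point :: "complex ^ 'm \<Rightarrow> (complex ^ 'm) set" where
  "proj_point z = {c *s z | c. c \<noteq> 0}"

definition proj_space :: "(complex ^ 'm) set set" where
  "proj_space = {proj_point z | z. z \<noteq> 0}"

definition proj_zeros :: "('m::finite, complex) mpoly set \<Rightarrow> (complex ^ 'm) set set" where
  "proj_zeros S = {P \<in> proj_space. \<forall>p\<in>S. \<forall>z\<in>P. eval p z = 0}"

definition hypersurface_singular_at ::
    "('m::finite, complex) mpoly \<Rightarrow> (complex ^ 'm) set \<Rightarrow> bool" where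
  "hypersurface_singular_at G P \<longleftrightarrow>
     P \<in> proj_zeros {G} \<and> (\<forall>v. \<forall>z\<in>P. eval (partial_deriv v G) z = 0)"

text \<open>A polynomial in \<open>x\<^sub>1, \<dots>, x\<^sub>n\<close> regarded as a polynomial in \<open>x\<^sub>0, x\<^sub>1, \<dots>, x\<^sub>n\<close>.\<close>

definition add_x0 :: "('n, complex) mpoly \<Rightarrow> ('n option, complex) mpoly" where
  "add_x0 p = poly_comp (\<lambda>i. Var (Some i)) p"

text \<open>The point \<open>[1 : y]\<close>.\<close>

definition affine_point :: "real ^ 'n \<Rightarrow> (complex ^ ('n::finite option)) set" where
  "affine_point y =
     proj_point (\<chi> k. case k of None \<Rightarrow> 1 | Some i \<Rightarrow> complex_of_real (y $ i))"

text \<open>The index type \<open>'n\<close> with its linear order plays the role of \<open>{1, \<dots>, n}\<close>, so \<open>Max UNIV\<close>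
  is the index \<open>n\<close> and \<open>i < Max UNIV\<close> means \<open>1 \<le> i \<le> n - 1\<close>.\<close>

definition curve ::
    "('n \<Rightarrow> ('n, real) mpoly) \<Rightarrow> ('n \<Rightarrow> nat) \<Rightarrow> real ^ 'n::{finite, linorder}
       \<Rightarrow> (complex ^ ('n option)) set set" where
  "curve \<eta> dg y = proj_zeros
     {add_x0 (complexify (\<eta> i)) - Const (complex_of_real (eval (\<eta> i) y)) * Var None ^ dg i
       | i. i < Max UNIV}"

end

theory Submission
  imports Defs
begin

text \<open>The real and imaginary parts of \<open>F\<close> are polynomials in the basic invariants, each of the
  form \<open>A + B \<eta>\<^sub>n\<close> with \<open>A, B\<close> weighted homogeneous in \<open>\<eta>\<^sub>1, \<dots>, \<eta>\<^sub>n\<^sub>-\<^sub>1\<close>, because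
  \<open>d < 2 d\<^sub>n\<close>. As the Jacobian of the Chevalley map is invertible at \<open>y\<close>, singularity at
  \<open>[1 : y]\<close> forces the gradient of \<open>A + B t\<^sub>n\<close> to vanish at \<open>\<eta>(y)\<close>, hence \<open>B\<close> and then \<open>A\<close>
  vanish at \<open>(\<eta>\<^sub>1(y), \<dots>, \<eta>\<^sub>n\<^sub>-\<^sub>1(y))\<close>. On the curve, \<open>\<eta>\<^sub>i = \<eta>\<^sub>i(y) x\<^sub>0\<^bsup>d\<^sub>i\<^esup>\<close> for \<open>i < n\<close>, so by
  weighted homogeneity \<open>A\<close> and \<open>B\<close> are multiples of their values at \<open>y\<close>.\<close>


subsection \<open>Substitution and evaluation\<close>

text \<open>Terms outside the support vanish because \<open>\<phi> 0 = 0\<close>, and absent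
  variables contribute factors 1. Substitutions into different polynomials can thus be compared over
  one common index set.\<close>

lemma poly_subst_eq_sum:
  fixes p :: "('v::finite, 'k::zero) mpoly"
  assumes "finite S" "Poly_Mapping.keys p \<subseteq> S" "\<phi> 0 = 0"
  shows "poly_subst \<phi> \<sigma> p =
    (\<Sum>m\<in>S. \<phi> (Poly_Mapping.lookup p m) * (\<Prod>v\<in>UNIV. \<sigma> v ^ Poly_Mapping.lookup m v))"
proof -
  have "(\<Prod>v\<in>Poly_Mapping.keys m. \<sigma> v ^ Poly_Mapping.lookup m v) =
        (\<Prod>v\<in>UNIV. \<sigma> v ^ Poly_Mapping.lookup m v)" for m :: "'v \<Rightarrow>\<^sub>0 nat"
    by (rule prod.mono_neutral_left) (auto simp: in_keys_iff)
  then show ?thesis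
    unfolding poly_subst_def using assms
    by (auto intro!: sum.mono_neutral_left simp: in_keys_iff)
qed

lemmas poly_subst_eq_sum_keys = poly_subst_eq_sum[OF finite_keys order_refl]

lemma poly_subst_zero [simp]: "poly_subst \<phi> \<sigma> 0 = 0"
  by (simp add: poly_subst_def)

lemma poly_subst_single:
  fixes m :: "'v::finite \<Rightarrow>\<^sub>0 nat"
  assumes "\<phi> 0 = 0"
  shows "poly_subst \<phi> \<sigma> (Poly_Mapping.single m c) =
    \<phi> c * (\<Prod>v\<in>UNIV. \<sigma> v ^ Poly_Mapping.lookup m v)"
  by (subst poly_subst_eq_sum[of "{m}"]) (use assms in auto)

lemma poly_subst_add:
  fixes p q :: "('v::finite, 'k::monoid_add) mpoly"
  assumes "\<phi> 0 = 0" "\<And>a b. \<phi> (a + b) = \<phi> a + \<phi> b"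
  shows "poly_subst \<phi> \<sigma> (p + q) = poly_subst \<phi> \<sigma> p + poly_subst \<phi> \<sigma> q"
proof -
  let ?S = "Poly_Mapping.keys p \<union> Poly_Mapping.keys q"
  have "Poly_Mapping.keys (p + q) \<subseteq> ?S"
    by (rule Poly_Mapping.keys_add)
  then show ?thesis
    using assms(1)
    by (simp add: poly_subst_eq_sum[of ?S] lookup_add assms(2) distrib_right sum.distrib)
qed

lemma poly_subst_sum:
  fixes f :: "'i \<Rightarrow> ('v::finite, 'k::comm_monoid_add) mpoly"
  assumes "\<phi> 0 = 0" "\<And>a b. \<phi> (a + b) = \<phi> a + \<phi> b"
  shows "poly_subst \<phi> \<sigma> (sum f A) = (\<Sum>i\<in>A. poly_subst \<phi> \<sigma> (f i))"
  by (induction A rule: infinite_finite_induct) (simp_all add: poly_subst_add assms)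

lemma poly_mapping_eq_sum_single:
  "p = (\<Sum>m\<in>Poly_Mapping.keys p. Poly_Mapping.single m (Poly_Mapping.lookup p m))"
  by (rule poly_mapping_eqI) (auto simp: lookup_sum lookup_single when_def in_keys_iff)

text \<open>Both factors are expanded into monomials; there exponents add, so powers of
  \<open>\<sigma> v\<close> multiply.\<close>

lemma poly_subst_mult:
  fixes p q :: "('v::finite, 'k::comm_ring_1) mpoly"
  assumes "\<phi> 0 = 0" "\<And>a b. \<phi> (a + b) = \<phi> a + \<phi> b" "\<And>a b. \<phi> (a * b) = \<phi> a * \<phi> b"
  shows "poly_subst \<phi> \<sigma> (p * q) = poly_subst \<phi> \<sigma> p * poly_subst \<phi> \<sigma> q"
proof -
  let ?t = "\<lambda>p m. Poly_Mapping.single m (Poly_Mapping.lookup p m)"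
  have "p * q = (\<Sum>m\<in>Poly_Mapping.keys p. ?t p m) * (\<Sum>n\<in>Poly_Mapping.keys q. ?t q n)"
    by (simp flip: poly_mapping_eq_sum_single)
  also have "\<dots> = (\<Sum>m\<in>Poly_Mapping.keys p. \<Sum>n\<in>Poly_Mapping.keys q.
      Poly_Mapping.single (m + n) (Poly_Mapping.lookup p m * Poly_Mapping.lookup q n))"
    by (simp add: sum_product mult_single)
  finally have "poly_subst \<phi> \<sigma> (p * q) =
      (\<Sum>m\<in>Poly_Mapping.keys p. \<Sum>n\<in>Poly_Mapping.keys q.
        \<phi> (Poly_Mapping.lookup p m) * \<phi> (Poly_Mapping.lookup q n) *
        (\<Prod>v\<in>UNIV. \<sigma> v ^ Poly_Mapping.lookup (m + n) v))"
    by (simp add: poly_subst_sum poly_subst_single assms)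
  then show ?thesis
    by (simp add: poly_subst_eq_sum_keys assms(1) sum_product lookup_add power_add prod.distrib
        mult_ac)
qed

text \<open>A ring homomorphism passes through sums, products and powers. It is used for evaluation,
  for the embedding \<open>of_real\<close> and for substitution of complex numbers into real
  polynomials.\<close>

lemma map_poly_subst:
  fixes \<phi> :: "'k::zero \<Rightarrow> 'a::comm_ring_1" and h :: "'a \<Rightarrow> 'b::comm_ring_1"
    and \<sigma> :: "'v \<Rightarrow> 'a"
  assumes "h 0 = 0" "h 1 = 1" "\<And>a b. h (a + b) = h a + h b" "\<And>a b. h (a * b) = h a * h b"
  shows "h (poly_subst \<phi> \<sigma> p) = poly_subst (\<lambda>c. h (\<phi> c)) (\<lambda>v. h (\<sigma> v)) p"
proof -
  have "h (sum f A) = (\<Sum>i\<in>A. h (f i))" for f and A :: "('v \<Rightarrow>\<^sub>0 nat) set"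
    by (induction A rule: infinite_finite_induct) (simp_all add: assms)
  moreover have "h (prod f A) = (\<Prod>i\<in>A. h (f i))" for f and A :: "'v set"
    by (induction A rule: infinite_finite_induct) (simp_all add: assms)
  moreover have "h (a ^ k) = h a ^ k" for a k
    by (induction k) (simp_all add: assms)
  ultimately show ?thesis
    by (simp add: poly_subst_def assms)
qed

lemma poly_subst_Const [simp]:
  fixes \<sigma> :: "'v::finite \<Rightarrow> _"
  shows "\<phi> 0 = 0 \<Longrightarrow> poly_subst \<phi> \<sigma> (Const c) = \<phi> c"
  by (simp add: Const_def poly_subst_single)

lemma poly_subst_Var [simp]:
  fixes v :: "'v::finite"
  assumes "\<phi> 0 = 0" "\<phi> 1 = 1"
  shows "poly_subst \<phi> \<sigma> (Var v) = \<sigma> v"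
proof -
  have "(\<Prod>u\<in>UNIV. \<sigma> u ^ Poly_Mapping.lookup (Poly_Mapping.single v 1) u) =
        (\<Prod>u\<in>UNIV. if v = u then \<sigma> u else 1)"
    by (intro prod.cong) (auto simp: lookup_single when_def)
  then show ?thesis
    using assms by (simp add: Var_def poly_subst_single)
qed

lemma Const_zero [simp]: "Const 0 = 0"
  by (simp add: Const_def)

lemma Const_one [simp]: "Const 1 = 1"
  by (simp add: Const_def)

lemma Const_add: "Const (a + b) = Const a + Const b"
  by (simp add: Const_def single_add)

lemma Const_mult: "Const (a * b) = Const a * Const b"
  for a b :: "'k::comm_ring_1"
  by (simp add: Const_def mult_single)

lemma poly_subst_one:
  fixes \<sigma> :: "'v::finite \<Rightarrow> _"
  assumes "\<phi> 0 = 0" "\<phi> 1 = 1"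
  shows "poly_subst \<phi> \<sigma> 1 = 1"
  using poly_subst_Const[of \<phi> \<sigma> 1] assms by simp

lemma lookup_Const_mult:
  fixes c :: "'k::comm_ring_1" and q :: "('v, 'k) mpoly"
  shows "Poly_Mapping.lookup (Const c * q) m = c * Poly_Mapping.lookup q m"
proof -
  have "Const c * q = Poly_Mapping.map ((*) c) q"
    by (simp add: Const_def mult_map_scale_conv_mult)
  then show ?thesis
    by (simp add: Poly_Mapping.map.rep_eq when_def)
qed

section \<open>Evaluation as a ring homomorphism\<close>

lemma eval_Const [simp]: "eval (Const c) x = c"
  by (simp add: eval_def)

lemma eval_Var [simp]: "eval (Var v) x = x $ v"
  by (simp add: eval_def)

lemma eval_add: "eval (p + q) x = eval p x + eval q x"
  by (simp add: eval_def poly_subst_add)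

lemma eval_zero [simp]: "eval 0 x = 0"
  by (simp add: eval_def)

lemma eval_sum: "eval (sum f A) x = (\<Sum>i\<in>A. eval (f i) x)"
  by (simp add: eval_def poly_subst_sum)

lemma eval_mult: "eval (p * q) x = eval p x * eval q x"
  by (simp add: eval_def poly_subst_mult)

lemma eval_diff: "eval (p - q) x = eval p x - eval q x"
  using eval_add[of "p - q" q x] by simp

lemma eval_one [simp]: "eval 1 x = 1"
  using eval_Const[of 1 x] by simp

lemma eval_power: "eval (p ^ k) x = eval p x ^ k"
  by (induction k) (simp_all add: eval_mult)

lemma eval_single:
  "eval (Poly_Mapping.single m c) x = c * (\<Prod>v\<in>UNIV. x $ v ^ Poly_Mapping.lookup m v)"
  by (simp add: eval_def poly_subst_single)

lemma eval_eq_sum: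
  "eval p x = (\<Sum>m\<in>Poly_Mapping.keys p.
     Poly_Mapping.lookup p m * (\<Prod>v\<in>UNIV. x $ v ^ Poly_Mapping.lookup m v))"
  by (simp add: eval_def poly_subst_eq_sum_keys)

lemma eval_poly_subst:
  "eval (poly_subst \<phi> \<sigma> p) x = poly_subst (\<lambda>c. eval (\<phi> c) x) (\<lambda>v. eval (\<sigma> v) x) p"
  by (rule map_poly_subst) (simp_all add: eval_add eval_mult)

lemma eval_poly_comp: "eval (poly_comp g p) x = eval p (\<chi> i. eval (g i) x)"
  by (simp add: poly_comp_def eval_poly_subst eval_def[of p])

lemma eval_complexify:
  "eval (complexify p) z = poly_subst complex_of_real (\<lambda>v. z $ v) p"
  by (simp add: complexify_def eval_poly_subst)

lemma eval_add_x0: "eval (add_x0 p) z = eval p (\<chi> i. z $ Some i)"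
  by (simp add: add_x0_def eval_poly_comp)

subsection \<open>Complexification\<close>

text \<open>Substituting the variables for themselves returns each monomial; this makes
  \<open>complexify\<close>, defined by substitution, computable coefficient by coefficient.\<close>

lemma prod_Var:
  "(\<Prod>v\<in>UNIV. Var v ^ Poly_Mapping.lookup m v) =
     (Poly_Mapping.single m 1 :: ('v::finite, 'k::comm_ring_1) mpoly)"
proof -
  have pow: "Var v ^ k = (Poly_Mapping.single (Poly_Mapping.single v k) 1 :: ('v, 'k) mpoly)"
    for v k
    by (induction k) (simp_all add: Var_def mult_single flip: single_add)
  have "(\<Prod>v\<in>A. Poly_Mapping.single (f v) 1) =
      (Poly_Mapping.single (\<Sum>v\<in>A. f v) 1 :: ('v, 'k) mpoly)" if "finite A" for f and A :: "'v set"
    using that by (induction A) (simp_all add: mult_single)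
  moreover have "(\<Sum>v\<in>UNIV. Poly_Mapping.single v (Poly_Mapping.lookup m v)) = m"
    by (rule poly_mapping_eqI) (simp add: lookup_sum lookup_single when_def)
  ultimately show ?thesis
    by (simp add: pow)
qed

lemma lookup_complexify:
  fixes p :: "('v::finite, real) mpoly"
  shows "Poly_Mapping.lookup (complexify p) m = complex_of_real (Poly_Mapping.lookup p m)"
proof -
  have "complexify p = (\<Sum>k\<in>Poly_Mapping.keys p.
      Const (complex_of_real (Poly_Mapping.lookup p k)) * Poly_Mapping.single k 1)"
    by (simp add: complexify_def poly_subst_eq_sum_keys prod_Var)
  then show ?thesis
    by (simp add: lookup_sum lookup_Const_mult lookup_single when_def if_distrib in_keys_iff
        cong: if_cong)
qed

lemma complexify_one [simp]: "complexify (1 :: ('v::finite, real) mpoly) = 1"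
  by (rule poly_mapping_eqI) (simp add: lookup_complexify lookup_one when_def)

lemma complexify_mult: "complexify (p * q) = complexify p * complexify q"
  for p q :: "('v::finite, real) mpoly"
  by (simp add: complexify_def poly_subst_mult Const_add Const_mult)

lemma complexify_sum: "complexify (sum f A) = (\<Sum>i\<in>A. complexify (f i))"
  for f :: "'i \<Rightarrow> ('v::finite, real) mpoly"
  by (simp add: complexify_def poly_subst_sum Const_add)

lemma complexify_power: "complexify (p ^ k) = complexify p ^ k"
  for p :: "('v::finite, real) mpoly"
  by (induction k) (simp_all add: complexify_mult)

lemma complexify_prod: "complexify (prod f A) = (\<Prod>i\<in>A. complexify (f i))"
  for f :: "'i \<Rightarrow> ('v::finite, real) mpoly"
  by (induction A rule: infinite_finite_induct) (simp_all add: complexify_mult)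

lemma complexify_Const [simp]:
  "complexify (Const c :: ('v::finite, real) mpoly) = Const (complex_of_real c)"
  by (simp add: complexify_def)

lemma complexify_Var [simp]: "complexify (Var v) = Var v"
  for v :: "'v::finite"
  by (simp add: complexify_def)

section \<open>Real-linear functionals applied to complex coefficients\<close>

lemma linear_mult_of_real:
  assumes "linear R"
  shows "R (c * complex_of_real r) = R c * (r::real)"
  using linear_scale[OF assms, of r c] by (simp add: scaleR_conv_of_real mult.commute)

text \<open>\<open>Poly_Mapping.map\<close> keeps zero coefficients zero, which agrees with applying
  \<open>R\<close> because \<open>R 0 = 0\<close>.\<close>

lemma lookup_map_linear:
  assumes "linear R"
  shows "Poly_Mapping.lookup (Poly_Mapping.map R p) m = R (Poly_Mapping.lookup p m)"
  using linear_0[OF assms] by (simp add: Poly_Mapping.map.rep_eq when_def)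

lemma keys_map_subset: "Poly_Mapping.keys (Poly_Mapping.map f p) \<subseteq> Poly_Mapping.keys p"
  by (auto simp: in_keys_iff Poly_Mapping.map.rep_eq)

text \<open>At a real point every monomial has a real value, and \<open>R\<close> takes out real
  factors.\<close>

lemma eval_map_linear:
  fixes p :: "('v::finite, complex) mpoly" and R :: "complex \<Rightarrow> real"
  assumes "linear R"
  shows "eval (Poly_Mapping.map R p) x = R (eval p (\<chi> i. complex_of_real (x $ i)))"
proof -
  define M where "M m = (\<Prod>v\<in>UNIV. x $ v ^ Poly_Mapping.lookup m v)" for m
  have "eval p (\<chi> i. complex_of_real (x $ i)) =
      (\<Sum>m\<in>Poly_Mapping.keys p. Poly_Mapping.lookup p m * complex_of_real (M m))"
    by (simp add: eval_eq_sum M_def)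
  moreover have "eval (Poly_Mapping.map R p) x =
      (\<Sum>m\<in>Poly_Mapping.keys p. R (Poly_Mapping.lookup p m) * M m)"
    unfolding eval_def
    by (subst poly_subst_eq_sum[OF finite_keys keys_map_subset])
      (simp_all add: lookup_map_linear[OF assms] M_def)
  ultimately show ?thesis
    by (simp add: linear_sum[OF assms] linear_mult_of_real[OF assms])
qed

text \<open>Reduces the vanishing of a complex polynomial to that of two polynomials with real
  coefficients. As \<open>z\<close> may be any complex point, the two values need not be
  real.\<close>

lemma eval_eq_Re_Im:
  fixes p :: "('v::finite, complex) mpoly"
  shows "eval p z =
    eval (complexify (Poly_Mapping.map Re p)) z + \<i> * eval (complexify (Poly_Mapping.map Im p)) z"
proof -
  have "linear Re" "linear Im"
    by (simp_all add: bounded_linear.linear bounded_linear_Re bounded_linear_Im)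
  then have "p = complexify (Poly_Mapping.map Re p) + Const \<i> * complexify (Poly_Mapping.map Im p)"
    by (intro poly_mapping_eqI)
      (simp add: lookup_add lookup_Const_mult lookup_complexify lookup_map_linear flip: complex_eq)
  then show ?thesis
    by (metis eval_add eval_mult eval_Const)
qed

text \<open>The matrix of \<open>inv w\<close> is real, so the group acts by substituting linear
  forms with real coefficients, and \<open>R\<close> commutes with this.\<close>

lemma act_map_linear:
  fixes F :: "('n::finite, complex) mpoly" and R :: "complex \<Rightarrow> real"
  assumes "linear R"
  shows "act w (Poly_Mapping.map R F) = Poly_Mapping.map R (act w F)"
proof (rule poly_mapping_eqI)
  fix k
  define L :: "'n \<Rightarrow> ('n, real) mpoly" where
    "L = (\<lambda>i. \<Sum>j\<in>UNIV. Const (of_real (matrix (inv w) $ i $ j)) * Var j)"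
  define M where "M m = (\<Prod>v\<in>UNIV. L v ^ Poly_Mapping.lookup m v)" for m :: "'n \<Rightarrow>\<^sub>0 nat"
  have L: "(\<lambda>i. \<Sum>j\<in>UNIV. Const (of_real (matrix (inv w) $ i $ j)) * Var j) =
      (\<lambda>i. complexify (L i))"
    by (simp add: L_def complexify_sum complexify_mult)
  have "act w F = (\<Sum>m\<in>Poly_Mapping.keys F. Const (Poly_Mapping.lookup F m) * complexify (M m))"
    by (simp add: act_def L poly_comp_def poly_subst_eq_sum_keys M_def complexify_prod
        complexify_power)
  moreover have "act w (Poly_Mapping.map R F) =
      (\<Sum>m\<in>Poly_Mapping.keys F. Const (R (Poly_Mapping.lookup F m)) * M m)"
    unfolding act_def poly_comp_def
    by (subst poly_subst_eq_sum[OF finite_keys keys_map_subset])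
      (simp_all add: lookup_map_linear[OF assms] M_def L_def)
  ultimately show "Poly_Mapping.lookup (act w (Poly_Mapping.map R F)) k =
      Poly_Mapping.lookup (Poly_Mapping.map R (act w F)) k"
    by (simp add: lookup_map_linear[OF assms] lookup_sum lookup_Const_mult lookup_complexify
        linear_sum[OF assms] linear_mult_of_real[OF assms])
qed

text \<open>The basic invariants generate the real invariant algebra, whereas \<open>F\<close> has
  complex coefficients; its real and imaginary parts are therefore treated separately.\<close>

lemma invariants_map_linear:
  fixes F :: "('n::finite, complex) mpoly" and R :: "complex \<Rightarrow> real"
  assumes "linear R" "F \<in> invariants W"
  shows "Poly_Mapping.map R F \<in> invariants W"
  using assms by (simp add: invariants_def act_map_linear)


subsection \<open>Homogeneity\<close>

lemma homogeneous_iff: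
  "homogeneous d p \<longleftrightarrow>
     (\<forall>m. Poly_Mapping.lookup p m \<noteq> 0 \<longrightarrow> (\<Sum>v\<in>UNIV. Poly_Mapping.lookup m v) = d)"
  for p :: "('v::finite, 'k::zero) mpoly"
proof -
  have "(\<Sum>v\<in>Poly_Mapping.keys m. Poly_Mapping.lookup m v) =
        (\<Sum>v\<in>UNIV. Poly_Mapping.lookup m v)" for m :: "'v \<Rightarrow>\<^sub>0 nat"
    by (rule sum.mono_neutral_left) (auto simp: in_keys_iff)
  then show ?thesis
    by (auto simp: homogeneous_def in_keys_iff)
qed

lemma lookup_homogeneous:
  fixes p :: "('v::finite, 'k::zero) mpoly"
  assumes "homogeneous a p" "(\<Sum>v\<in>UNIV. Poly_Mapping.lookup m v) \<noteq> a"
  shows "Poly_Mapping.lookup p m = 0"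
  using assms unfolding homogeneous_iff by metis

lemma homogeneous_map:
  assumes "homogeneous d p"
  shows "homogeneous d (Poly_Mapping.map f p)"
  using assms keys_map_subset[of f p] by (auto simp: homogeneous_def)

lemma homogeneous_one: "homogeneous 0 (1 :: ('v::finite, 'k::comm_ring_1) mpoly)"
  by (simp add: homogeneous_iff lookup_one when_def)

lemma homogeneous_mult:
  fixes p q :: "('v::finite, 'k::comm_ring_1) mpoly"
  assumes "homogeneous a p" "homogeneous b q"
  shows "homogeneous (a + b) (p * q)"
  unfolding homogeneous_iff
proof (intro allI impI)
  fix m assume "Poly_Mapping.lookup (p * q) m \<noteq> 0"
  then obtain k l where "m = k + l" "k \<in> Poly_Mapping.keys p" "l \<in> Poly_Mapping.keys q"
    using keys_mult[of p q] by (auto simp: in_keys_iff)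
  then show "(\<Sum>v\<in>UNIV. Poly_Mapping.lookup m v) = a + b"
    using assms by (simp add: homogeneous_iff in_keys_iff lookup_add sum.distrib)
qed

lemma homogeneous_power:
  fixes p :: "('v::finite, 'k::comm_ring_1) mpoly"
  assumes "homogeneous a p"
  shows "homogeneous (a * k) (p ^ k)"
  by (induction k) (simp_all add: homogeneous_one homogeneous_mult assms)

lemma homogeneous_prod:
  fixes f :: "'i \<Rightarrow> ('v::finite, 'k::comm_ring_1) mpoly"
  assumes "\<And>i. i \<in> A \<Longrightarrow> homogeneous (a i) (f i)"
  shows "homogeneous (sum a A) (prod f A)"
  using assms
proof (induction A rule: infinite_finite_induct)
  case (insert x A)
  then have "homogeneous (a x + sum a A) (f x * prod f A)"
    by (intro homogeneous_mult) auto
  with insert.hyps show ?case by simp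
qed (simp_all add: homogeneous_one)

text \<open>The truncation of \<open>P\<close> to weighted degree \<open>d\<close> has the same value at \<open>\<eta>\<close>.\<close>

lemma homogeneous_poly_compE:
  fixes \<eta> :: "'w::finite \<Rightarrow> ('v::finite, 'k::comm_ring_1) mpoly"
  assumes \<eta>: "\<And>i. homogeneous (dg i) (\<eta> i)" and hom: "homogeneous d (poly_comp \<eta> P)"
  obtains Q where "poly_comp \<eta> Q = poly_comp \<eta> P"
    and "\<forall>m\<in>Poly_Mapping.keys Q. (\<Sum>i\<in>UNIV. dg i * Poly_Mapping.lookup m i) = d"
proof
  \<comment> \<open>\<open>wt m\<close> is the degree in the original variables of the monomial
    \<open>M m\<close> in the \<open>\<eta> i\<close>.\<close>
  define wt where "wt m = (\<Sum>i\<in>UNIV. dg i * Poly_Mapping.lookup m i)" for m :: "'w \<Rightarrow>\<^sub>0 nat"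
  define M where "M m = (\<Prod>i\<in>UNIV. \<eta> i ^ Poly_Mapping.lookup m i)" for m :: "'w \<Rightarrow>\<^sub>0 nat"
  define Q where "Q = (\<Sum>m\<in>{m \<in> Poly_Mapping.keys P. wt m = d}.
      Poly_Mapping.single m (Poly_Mapping.lookup P m))"
  have Q: "Poly_Mapping.lookup Q m = (if wt m = d then Poly_Mapping.lookup P m else 0)" for m
    by (auto simp: Q_def lookup_sum lookup_single when_def in_keys_iff)
  then have keys: "Poly_Mapping.keys Q \<subseteq> Poly_Mapping.keys P"
    by (auto simp: in_keys_iff split: if_splits)
  show "\<forall>m\<in>Poly_Mapping.keys Q. (\<Sum>i\<in>UNIV. dg i * Poly_Mapping.lookup m i) = d"
    by (auto simp: in_keys_iff Q simp flip: wt_def split: if_splits)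
  have M: "homogeneous (wt m) (M m)" for m
    unfolding wt_def M_def by (intro homogeneous_prod homogeneous_power \<eta>)
  have P: "poly_comp \<eta> P = (\<Sum>m\<in>Poly_Mapping.keys P. Const (Poly_Mapping.lookup P m) * M m)"
    by (simp add: poly_comp_def poly_subst_eq_sum_keys M_def)
  have Q': "poly_comp \<eta> Q = (\<Sum>m\<in>Poly_Mapping.keys P. Const (Poly_Mapping.lookup Q m) * M m)"
    unfolding poly_comp_def by (subst poly_subst_eq_sum[OF finite_keys keys]) (simp_all add: M_def)
  show "poly_comp \<eta> Q = poly_comp \<eta> P"
  proof (rule poly_mapping_eqI)
    fix k
    show "Poly_Mapping.lookup (poly_comp \<eta> Q) k = Poly_Mapping.lookup (poly_comp \<eta> P) k"
    \<comment> \<open>In degree \<open>d\<close> only the monomials kept in \<open>Q\<close>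
      contribute. In any other degree \<open>Q\<close> contributes nothing, and the coefficient for
      \<open>P\<close> is zero by \<open>hom\<close>.\<close>
    proof (cases "(\<Sum>v\<in>UNIV. Poly_Mapping.lookup k v) = d")
      case True
      then have "Poly_Mapping.lookup (M m) k = 0" if "wt m \<noteq> d" for m
        using that by (intro lookup_homogeneous[OF M]) simp
      then show ?thesis
        by (auto simp: P Q' Q lookup_sum lookup_Const_mult intro!: sum.cong)
    next
      case False
      with hom have "Poly_Mapping.lookup (poly_comp \<eta> P) k = 0"
        by (rule lookup_homogeneous)
      moreover have "Poly_Mapping.lookup (M m) k = 0" if "wt m = d" for m
        using False that by (intro lookup_homogeneous[OF M]) simp
      then have "Poly_Mapping.lookup (poly_comp \<eta> Q) k = 0"
        by (auto simp: Q' Q lookup_sum lookup_Const_mult intro!: sum.neutral)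
      ultimately show ?thesis by simp
    qed
  qed
qed

text \<open>A polynomial of weighted degree \<open>d < 2 * dg N\<close> is of the form \<open>A + B t\<^sub>N\<close>.\<close>

lemma weighted_homogeneous_affine:
  fixes P :: "('w::finite, real) mpoly" and c :: "'w \<Rightarrow> real"
  assumes wt: "\<forall>m\<in>Poly_Mapping.keys P. (\<Sum>i\<in>UNIV. dg i * Poly_Mapping.lookup m i) = d"
    and d: "d < 2 * dg N"
  obtains A B where "\<forall>(e :: 'w \<Rightarrow> 'b::real_field) x.
      (\<forall>i. i \<noteq> N \<longrightarrow> e i = of_real (c i) * x ^ dg i) \<longrightarrow>
      poly_subst of_real e P = of_real A * x ^ d + of_real B * x ^ (d - dg N) * e N"
    and "\<forall>e. (\<forall>i. i \<noteq> N \<longrightarrow> e i = c i) \<longrightarrow> poly_subst (\<lambda>r. r) e P = A + B * e N"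
proof -
  \<comment> \<open>The coefficient of \<open>m\<close> times the value at \<open>c\<close> of its
    factors other than the power of variable \<open>N\<close>.\<close>
  define M where "M m = Poly_Mapping.lookup P m * (\<Prod>i\<in>UNIV - {N}. c i ^ Poly_Mapping.lookup m i)"
    for m
  define A where "A = (\<Sum>m\<in>{m\<in>Poly_Mapping.keys P. Poly_Mapping.lookup m N = 0}. M m)"
  define B where "B = (\<Sum>m\<in>{m\<in>Poly_Mapping.keys P. Poly_Mapping.lookup m N = 1}. M m)"
  have wt': "dg N * Poly_Mapping.lookup m N + (\<Sum>i\<in>UNIV - {N}. dg i * Poly_Mapping.lookup m i) = d"
    if "m \<in> Poly_Mapping.keys P" for m
    using bspec[OF wt that] by (simp add: sum.remove[of UNIV N])
  \<comment> \<open>A square of variable \<open>N\<close> would already have weight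
    \<open>2 * dg N\<close>, which exceeds \<open>d\<close>.\<close>
  have le1: "Poly_Mapping.lookup m N = 0 \<or> Poly_Mapping.lookup m N = 1"
    if "m \<in> Poly_Mapping.keys P" for m
  proof -
    have "dg N * Poly_Mapping.lookup m N < dg N * 2"
      using wt'[OF that] d by linarith
    then show ?thesis
      by (auto simp: less_2_cases_iff)
  qed
  have gen: "poly_subst of_real e P = of_real A * x ^ d + of_real B * x ^ (d - dg N) * e N"
    if e: "\<forall>i. i \<noteq> N \<longrightarrow> e i = of_real (c i) * x ^ dg i"
    for e :: "'w \<Rightarrow> 'b" and x
  proof -
    \<comment> \<open>The variables other than \<open>N\<close> carry exactly the remaining weight,
      which becomes the exponent of \<open>x\<close>.\<close>
    have monom: "of_real (Poly_Mapping.lookup P m) * (\<Prod>i\<in>UNIV. e i ^ Poly_Mapping.lookup m i) =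
        of_real (M m) * x ^ (d - dg N * Poly_Mapping.lookup m N) * e N ^ Poly_Mapping.lookup m N"
      if m: "m \<in> Poly_Mapping.keys P" for m
    proof -
      have "(\<Prod>i\<in>UNIV - {N}. e i ^ Poly_Mapping.lookup m i) =
          of_real (\<Prod>i\<in>UNIV - {N}. c i ^ Poly_Mapping.lookup m i) *
          x ^ (\<Sum>i\<in>UNIV - {N}. dg i * Poly_Mapping.lookup m i)"
        by (simp add: e power_mult_distrib prod.distrib power_sum flip: power_mult)
      also have "(\<Sum>i\<in>UNIV - {N}. dg i * Poly_Mapping.lookup m i) =
          d - dg N * Poly_Mapping.lookup m N"
        using wt'[OF m] by linarith
      finally show ?thesis
        by (simp add: prod.remove[of UNIV N] M_def mult_ac)
    qed
    \<comment> \<open>These two parts give \<open>A\<close> and \<open>B\<close>. Truncation in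
      \<open>d - dg N\<close> is harmless: if \<open>d < dg N\<close>, the second part is empty and
      \<open>B = 0\<close>.\<close>
    have keys: "Poly_Mapping.keys P = {m\<in>Poly_Mapping.keys P. Poly_Mapping.lookup m N = 0} \<union>
        {m\<in>Poly_Mapping.keys P. Poly_Mapping.lookup m N = 1}" (is "_ = ?K0 \<union> ?K1")
      using le1 by auto
    have "poly_subst of_real e P = (\<Sum>m\<in>Poly_Mapping.keys P.
        of_real (M m) * x ^ (d - dg N * Poly_Mapping.lookup m N) * e N ^ Poly_Mapping.lookup m N)"
      by (simp add: poly_subst_eq_sum_keys monom)
    also have "\<dots> = (\<Sum>m\<in>?K0. of_real (M m) * x ^ d) +
        (\<Sum>m\<in>?K1. of_real (M m) * x ^ (d - dg N) * e N)"
      by (subst keys, subst sum.union_disjoint) auto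
    finally show ?thesis
      by (simp add: A_def B_def sum_distrib_right)
  qed
  \<comment> \<open>The real identity is the case \<open>x = 1\<close>, pulled back along the
    injective map \<open>of_real\<close>.\<close>
  have "poly_subst (\<lambda>r. r) e P = A + B * e N" if "\<forall>i. i \<noteq> N \<longrightarrow> e i = c i" for e
  proof -
    have "of_real (poly_subst (\<lambda>r. r) e P) = (of_real (A + B * e N) :: 'b)"
      using gen[of "\<lambda>i. of_real (e i)" 1] that
      by (simp add: map_poly_subst[of "of_real :: real \<Rightarrow> 'b"])
    then show ?thesis
      by (simp only: of_real_eq_iff)
  qed
  with gen show thesis
    by (intro that[of A B]) simp_all
qed


subsection \<open>Derivatives\<close>

text \<open>Links the formal partial derivative to analysis, over the real and the complex numbers
  alike: along an axis each monomial is a power of one coordinate times a constant.\<close>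

lemma has_field_derivative_eval_axis:
  fixes p :: "('v::finite, 'k::real_normed_field) mpoly"
  shows "((\<lambda>t. eval p (z + t *s axis v 1)) has_field_derivative eval (partial_deriv v p) z) (at 0)"
proof -
  define M where "M m = (\<Prod>u\<in>UNIV - {v}. z $ u ^ Poly_Mapping.lookup m u)" for m :: "'v \<Rightarrow>\<^sub>0 nat"
  have "(\<Prod>u\<in>UNIV - {v}. (z $ u + t * axis v 1 $ u) ^ Poly_Mapping.lookup m u) = M m" for t m
    unfolding M_def by (rule prod.cong) (auto simp: axis_def)
  then have 1: "eval p (z + t *s axis v 1) = (\<Sum>m\<in>Poly_Mapping.keys p.
      Poly_Mapping.lookup p m * ((z $ v + t) ^ Poly_Mapping.lookup m v * M m))" for t
    by (simp add: eval_eq_sum prod.remove[of UNIV v] axis_def)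
  \<comment> \<open>Lowering the exponent of \<open>v\<close> leaves the other factors alone; if
    that exponent is 0, the factor \<open>of_nat\<close> kills the term.\<close>
  have "(\<Prod>u\<in>UNIV - {v}. z $ u ^ Poly_Mapping.lookup (m - Poly_Mapping.single v 1) u) = M m" for m
    unfolding M_def by (rule prod.cong) (auto simp: lookup_minus lookup_single)
  then have 2: "eval (partial_deriv v p) z = (\<Sum>m\<in>Poly_Mapping.keys p.
      Poly_Mapping.lookup p m * (of_nat (Poly_Mapping.lookup m v) *
        z $ v ^ (Poly_Mapping.lookup m v - 1) * M m))"
    by (simp add: partial_deriv_def eval_sum eval_single prod.remove[of UNIV v] lookup_minus mult_ac)
  show ?thesis
    unfolding 1 2 by (auto intro!: derivative_eq_intros sum.cong)
qed

lemma differentiable_eval: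
  fixes p :: "('v::finite, real) mpoly"
  shows "eval p differentiable (at x)"
proof -
  have nth: "(\<lambda>x::real^'v. x $ v) differentiable (at x)" for v
    by (intro bounded_linear_imp_differentiable bounded_linear_vec_nth)
  have "(\<lambda>x::real^'v. \<Prod>v\<in>A. x $ v ^ k v) differentiable (at x)" for A k
    by (induction A rule: infinite_finite_induct)
      (simp_all add: differentiable_mult differentiable_power nth)
  then show ?thesis
    unfolding eval_eq_sum[abs_def] by (intro differentiable_sum differentiable_mult) auto
qed

lemma differentiable_chevalley_map: "chevalley_map \<eta> differentiable (at y)"
  by (subst differentiable_componentwise_within) (auto simp: Basis_vec_def chevalley_map_def inner_axis differentiable_eval)

section \<open>From singular points to critical points of the Chevalley map composites\<close>

lemma singular_at_affine_point_map_linear: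
  fixes F :: "('n::finite, complex) mpoly" and R :: "complex \<Rightarrow> real"
  assumes R: "bounded_linear R" and sing: "hypersurface_singular_at (add_x0 F) (affine_point y)"
  shows "eval (Poly_Mapping.map R F) y = 0"
    and "((\<lambda>s. eval (Poly_Mapping.map R F) (y + s *\<^sub>R axis j 1)) has_vector_derivative 0) (at 0)"
proof -
  note lin = bounded_linear.linear[OF R]
  \<comment> \<open>The representative of the point with \<open>x\<^sub>0 = 1\<close>.\<close>
  define z :: "complex ^ ('n option)" where
    "z = (\<chi> k. case k of None \<Rightarrow> 1 | Some i \<Rightarrow> complex_of_real (y $ i))"
  have "1 *s z \<in> affine_point y"
    unfolding affine_point_def proj_point_def z_def mem_Collect_eq
    by (intro exI[of _ 1]) simp
  then have z: "z \<in> affine_point y" by simp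
  with sing have "eval (add_x0 F) z = 0" and D: "eval (partial_deriv (Some j) (add_x0 F)) z = 0"
    by (auto simp: hypersurface_singular_at_def proj_zeros_def)
  then show "eval (Poly_Mapping.map R F) y = 0"
    by (simp add: eval_map_linear[OF lin] eval_add_x0 z_def linear_0[OF lin])
  have *: "eval (Poly_Mapping.map R F) (y + s *\<^sub>R axis j 1) =
      R (eval (add_x0 F) (z + complex_of_real s *s axis (Some j) 1))" for s
    by (auto simp: eval_map_linear[OF lin] eval_add_x0 z_def axis_def
        intro!: arg_cong[of _ _ R] arg_cong[of _ _ "eval F"] simp: vec_eq_iff)
  \<comment> \<open>The complex derivative is restricted to real parameters and then composed with
    \<open>R\<close>; writing the base point as \<open>complex_of_real 0\<close> fits the
    restriction rule.\<close>
  have "((\<lambda>t. eval (add_x0 F) (z + t *s axis (Some j) 1)) has_field_derivative 0)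
      (at (complex_of_real 0))"
    using has_field_derivative_eval_axis[of "add_x0 F" z "Some j"] D by simp
  from bounded_linear.has_vector_derivative[OF R has_vector_derivative_real_field[OF this]]
  show "((\<lambda>s. eval (Poly_Mapping.map R F) (y + s *\<^sub>R axis j 1)) has_vector_derivative 0) (at 0)"
    unfolding * by (simp add: linear_0[OF lin])
qed

text \<open>By the chain rule the differential of the composite at \<open>y\<close> is
  \<open>D\<close> after \<open>J\<close>. It vanishes on the coordinate axes, hence everywhere, and
  \<open>J\<close> is onto, so \<open>D\<close> vanishes.\<close>

lemma critical_chevalley_composite:
  fixes \<eta> :: "'n \<Rightarrow> ('n::finite, real) mpoly"
  assumes det: "det (jacobian (chevalley_map \<eta>) (at y)) \<noteq> 0"
    and crit: "\<And>j. ((\<lambda>s. eval (poly_comp \<eta> P) (y + s *\<^sub>R axis j 1)) has_vector_derivative 0) (at 0)"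
  shows "(eval P has_derivative (\<lambda>_. 0)) (at (chevalley_map \<eta> y))"
proof -
  define J where "J = jacobian (chevalley_map \<eta>) (at y)"
  define D where "D = frechet_derivative (eval P) (at (chevalley_map \<eta> y))"
  have D: "(eval P has_derivative D) (at (chevalley_map \<eta> y))"
    unfolding D_def by (simp add: differentiable_eval flip: frechet_derivative_works)
  then have lin: "linear D" by (rule has_derivative_linear)
  have "(chevalley_map \<eta> has_derivative (*v) J) (at y)"
    unfolding J_def using differentiable_chevalley_map jacobian_works by blast
  from has_derivative_compose[OF this D]
  have f: "(eval (poly_comp \<eta> P) has_derivative (\<lambda>h. D (J *v h))) (at y)"
    by (simp add: eval_poly_comp[abs_def] chevalley_map_def)
  have axis: "D (J *v axis j 1) = 0" for j
  proof -
    have "((\<lambda>s. y + s *\<^sub>R axis j 1) has_derivative (\<lambda>s. s *\<^sub>R axis j 1)) (at 0)"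
      by (auto intro!: derivative_eq_intros)
    moreover have "(eval (poly_comp \<eta> P) has_derivative (\<lambda>h. D (J *v h)))
        (at (y + 0 *\<^sub>R axis j 1))"
      using f by simp
    ultimately have "((\<lambda>s. eval (poly_comp \<eta> P) (y + s *\<^sub>R axis j 1)) has_derivative
        (\<lambda>s. D (J *v (s *\<^sub>R axis j 1)))) (at 0)"
      by (rule has_derivative_compose)
    from has_derivative_unique[OF this crit[of j, unfolded has_vector_derivative_def]]
    show ?thesis by (metis scaleR_one scaleR_zero_right)
  qed
  have "(\<lambda>h. D (J *v h)) = (\<lambda>_. 0)"
  proof (rule linear_eq_stdbasis)
    show "linear (\<lambda>h. D (J *v h))"
      using has_derivative_linear[OF f] .
    show "linear (\<lambda>_::real^'n. 0::real)"
      by (rule module_hom_zero)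
    show "D (J *v b) = 0" if "b \<in> Basis" for b
      using that axis by (auto simp: Basis_vec_def)
  qed
  moreover have "surj ((*v) J)"
    using det by (metis J_def invertible_det_nz invertible_right_inverse matrix_right_invertible_surjective)
  ultimately have "D = (\<lambda>_. 0)"
    by (metis surjD ext)
  with D show ?thesis by simp
qed

text \<open>The core argument for one polynomial \<open>f\<close> with real coefficients. The point
  \<open>z\<close> is complex, and \<open>x\<close> stands for its coordinate
  \<open>x\<^sub>0\<close>.\<close>

lemma critical_composite_vanishes:
  fixes \<eta> :: "'n \<Rightarrow> ('n::finite, real) mpoly"
  assumes \<eta>: "\<And>i. homogeneous (dg i) (\<eta> i)"
    and det: "det (jacobian (chevalley_map \<eta>) (at y)) \<noteq> 0"
    and f: "f \<in> range (poly_comp \<eta>)" and hom: "homogeneous d f" and d: "d < 2 * dg N"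
    and zero: "eval f y = 0"
    and crit: "\<And>j. ((\<lambda>s. eval f (y + s *\<^sub>R axis j 1)) has_vector_derivative 0) (at 0)"
    and z: "\<And>i. i \<noteq> N \<Longrightarrow>
      eval (complexify (\<eta> i)) z = complex_of_real (eval (\<eta> i) y) * x ^ dg i"
  shows "eval (complexify f) z = 0"
proof -
  from f obtain P where P: "f = poly_comp \<eta> P" by blast
  obtain Q where "poly_comp \<eta> Q = poly_comp \<eta> P"
    and wt: "\<forall>m\<in>Poly_Mapping.keys Q. (\<Sum>i\<in>UNIV. dg i * Poly_Mapping.lookup m i) = d"
    by (rule homogeneous_poly_compE[OF \<eta> hom[unfolded P]])
  with P have Q: "f = poly_comp \<eta> Q" by simp
  define c where "c = chevalley_map \<eta> y"
  obtain A B where AB: "\<forall>e x. (\<forall>i. i \<noteq> N \<longrightarrow> e i = complex_of_real (c $ i) * x ^ dg i) \<longrightarrow>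
      poly_subst complex_of_real e Q = of_real A * x ^ d + of_real B * x ^ (d - dg N) * e N"
    and AB': "\<forall>e. (\<forall>i. i \<noteq> N \<longrightarrow> e i = c $ i) \<longrightarrow> poly_subst (\<lambda>r. r) e Q = A + B * e N"
    by (rule weighted_homogeneous_affine[OF wt d, where 'b = complex and c = "\<lambda>i. c $ i"])
  \<comment> \<open>Only coordinate \<open>N\<close> moves along this line, so \<open>Q\<close>
    restricts to an affine function of slope \<open>B\<close>; the vanishing gradient at
    \<open>c\<close> then gives \<open>B = 0\<close>.\<close>
  have line: "eval Q (c + s *\<^sub>R axis N 1) = A + B * (c $ N + s)" for s
    unfolding eval_def by (subst AB'[rule_format]) (auto simp: axis_def)
  have "(eval Q has_derivative (\<lambda>_. 0)) (at c)"
    unfolding c_def using det crit by (intro critical_chevalley_composite) (simp_all add: Q)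
  then have "(eval Q has_derivative (\<lambda>_. 0)) (at (c + 0 *\<^sub>R axis N 1))"
    by simp
  moreover have "((\<lambda>s. c + s *\<^sub>R axis N 1) has_derivative (\<lambda>s. s *\<^sub>R axis N 1)) (at 0)"
    by (auto intro!: derivative_eq_intros)
  ultimately have "((\<lambda>s. eval Q (c + s *\<^sub>R axis N 1)) has_derivative (\<lambda>_. 0)) (at 0)"
    by (rule has_derivative_compose[rotated])
  then have "((\<lambda>s. A + B * (c $ N + s)) has_field_derivative 0) (at 0)"
    by (simp add: line has_field_derivative_def lambda_zero)
  moreover have "((\<lambda>s. A + B * (c $ N + s)) has_field_derivative B) (at 0)"
    by (auto intro!: derivative_eq_intros)
  ultimately have B: "B = 0"
    by (rule DERIV_unique[symmetric])
  have "eval Q c = 0"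
    using zero by (simp add: Q eval_poly_comp c_def chevalley_map_def)
  with line[of 0] B have A: "A = 0" by simp
  have "eval (complexify f) z =
      poly_subst complex_of_real (\<lambda>i. eval (complexify (\<eta> i)) z) Q"
    unfolding eval_complexify Q poly_comp_def
    by (subst map_poly_subst[of "poly_subst complex_of_real (($) z)"]) (simp_all add: poly_subst_one poly_subst_add poly_subst_mult)
  \<comment> \<open>The equations \<open>z\<close> are the hypothesis of \<open>AB\<close>; the
    value of \<open>\<eta> N\<close> at \<open>z\<close> stays free, its factor being
    \<open>B = 0\<close>.\<close>
  also have "\<dots> = 0"
    by (subst AB[rule_format, of _ x]) (simp_all add: z A B c_def chevalley_map_def)
  finally show ?thesis .
qed

theorem theorem4p2:
  fixes \<Phi> :: "(real ^ 'n::{finite, linorder}) set"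
    and \<eta> :: "'n \<Rightarrow> ('n, real) mpoly"
    and dg :: "'n \<Rightarrow> nat"
    and y :: "real ^ 'n::{finite, linorder}"
    and F :: "('n, complex) mpoly"
    and d :: nat
  assumes "root_system \<Phi>"
    and "basic_invariants (reflection_group \<Phi>) \<eta> dg"
    and "mono dg"
    and "det (jacobian (chevalley_map \<eta>) (at y)) \<noteq> 0"
    and "F \<in> invariants (reflection_group \<Phi>)"
    and "homogeneous d F"
    and "d < 2 * dg (Max UNIV)"
    and "hypersurface_singular_at (add_x0 F) (affine_point y)"
  shows "curve \<eta> dg y \<subseteq> proj_zeros {add_x0 F}"
proof -
  have \<eta>: "homogeneous (dg i) (\<eta> i)" for i
    using assms(2) by (simp add: basic_invariants_def)
  have "eval (add_x0 F) z = 0" if X: "X \<in> curve \<eta> dg y" and z: "z \<in> X" for X z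
  proof -
    define x where "x = (\<chi> i. z $ Some i)"
    \<comment> \<open>The coordinate \<open>z $ None\<close> may be 0, so points of the curve at
      infinity are covered too.\<close>
    have x: "eval (complexify (\<eta> i)) x = complex_of_real (eval (\<eta> i) y) * z $ None ^ dg i"
      if "i \<noteq> Max UNIV" for i
    proof -
      have "i < Max UNIV"
        using that by (simp add: less_le)
      then have "eval (add_x0 (complexify (\<eta> i)) -
          Const (complex_of_real (eval (\<eta> i) y)) * Var None ^ dg i) z = 0"
        using X z unfolding curve_def proj_zeros_def by blast
      then show ?thesis
        by (simp add: eval_diff eval_mult eval_power eval_add_x0 x_def)
    qed
    \<comment> \<open>Applied below with \<open>R\<close> equal to \<open>Re\<close> and to
      \<open>Im\<close>.\<close>
    have "eval (complexify (Poly_Mapping.map R F)) x = 0" if R: "bounded_linear R" for R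
    proof (rule critical_composite_vanishes[OF \<eta> assms(4) _ _ assms(7) _ _ x])
      show "Poly_Mapping.map R F \<in> range (poly_comp \<eta>)"
        using assms(2,5) R by (simp add: basic_invariants_def invariants_map_linear bounded_linear.linear)
    qed (use assms(6,8) R in \<open>simp_all add: homogeneous_map singular_at_affine_point_map_linear\<close>)
    then have "eval F x = 0"
      by (simp add: eval_eq_Re_Im[of F] bounded_linear_Re bounded_linear_Im)
    then show ?thesis
      by (simp add: eval_add_x0 x_def)
  qed
  then show ?thesis
    by (auto simp: curve_def proj_zeros_def)
qed

end
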